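(* Let $G(V,E,P)$ be a social network, $\theta$ a cut-off probability, and let $(\mathcal{N},\nu)$ be the associated BIM Game, i.e. $\mathcal{N}=V(G)$ and $\nu(S)=\sigma(S)$ for every $S\subseteq V(G)$, where $\sigma(S)$ is the expected influence of $S$ under the MIA diffusion model. Then the game is sub-additive: for any two coalitions $\mathcal{U}_1,\mathcal{U}_2\subseteq\mathcal{N}$, $$\nu(\mathcal{U}_1\cup\mathcal{U}_2)\le\nu(\mathcal{U}_1)+\nu(\mathcal{U}_2).$$
   Context: A social network is a finite graph $G(V,E,P)$ with $V(G)=\{u_1,\dots,u_n\}$ and $P:E(G)\to(0,1]$; $P_{uv}$ is the influence probability of the edge $(uv)$ (an undirected edge is treated as two oppositely directed edges with the same probability), and $P_{uv}=0$ if $(uv)\notin E(G)$. Propagation probability: for a path $p$ in $G$, $\mathcal{P}(p)$ is the product of the influence probabilities of its edges. For $u\ne v$, $p^{max}_{u,v}$ is a path from $u$ to $v$ maximizing $\mathcal{P}$ (if a path exists; otherwise the propagation probability is $0$), with ties broken consistently so that, for each $v$, the chosen paths into $v$ form an in-arborescence rooted at $v$. MIIA: for $v\in V(G)$ and a threshold $\theta\in(0,1]$, $MIIA(v,\theta)$ is the union of the paths $p^{max}_{u,v}$ over all $u\in V(G)\setminus\{v\}$ with $\mathcal{P}(p^{max}_{u,v})\ge\theta$ (together with the root $v$ itself). Activation probability: for $S\subseteq V(G)$ and $A=MIIA(v,\theta)$, the number $ap(u,S,A)$ for nodes $u$ of $A$ is defined recursively: it equals $1$ if $u\in S$; it equals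 $0$ if $u\notin S$ and $u$ has no in-neighbour in $A$; otherwise it equals $1-\prod_{w}\bigl(1-ap(w,S,A)\,P_{wu}\bigr)$, the product being over the in-neighbours $w$ of $u$ in $A$. MIA diffusion model: the expected influence of $S\subseteq V(G)$ is $\sigma(S)=\sum_{v\in V(G)} ap(v,S,MIIA(v,\theta))$. BIM Game: the co-operative game $(\mathcal{N},\nu)$ with player set $\mathcal{N}=V(G)$ and utility $\nu:2^{V(G)}\to\mathbb{R}_{\ge 0}$, $\nu(S)=\sigma(S)$. A coalition is any subset of $\mathcal{N}$. *)

theory Defs
  imports Complex_Main "Graph_Theory.Graph_Theory"
begin

text \<open>
  Arcs are ordered pairs; an undirected edge is represented by its two opposite arcs.
  Loops are not excluded.
\<close>

locale social_network = pair_fin_digraph G for G :: "'a pair_pre_digraph" +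
  fixes P :: "'a \<times> 'a \<Rightarrow> real"
  assumes P_arc: "e \<in> parcs G \<Longrightarrow> 0 < P e \<and> P e \<le> 1"
    and P_non_arc: "e \<notin> parcs G \<Longrightarrow> P e = 0"

abbreviation is_walk :: "'a pair_pre_digraph \<Rightarrow> 'a \<Rightarrow> ('a \<times> 'a) awalk \<Rightarrow> 'a \<Rightarrow> bool" where
  "is_walk G \<equiv> pre_digraph.awalk (with_proj G)"

abbreviation is_path :: "'a pair_pre_digraph \<Rightarrow> 'a \<Rightarrow> ('a \<times> 'a) awalk \<Rightarrow> 'a \<Rightarrow> bool" where
  "is_path G \<equiv> pre_digraph.apath (with_proj G)"

definition path_prob :: "('a \<times> 'a \<Rightarrow> real) \<Rightarrow> ('a \<times> 'a) awalk \<Rightarrow> real" where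
  "path_prob P p = prod_list (map P p)"

definition max_path ::
  "'a pair_pre_digraph \<Rightarrow> ('a \<times> 'a \<Rightarrow> real) \<Rightarrow> 'a \<Rightarrow> ('a \<times> 'a) awalk \<Rightarrow> 'a \<Rightarrow> bool" where
  "max_path G P u p v \<longleftrightarrow>
     is_path G u p v \<and> (\<forall>q. is_path G u q v \<longrightarrow> path_prob P q \<le> path_prob P p)"

text \<open>
  Uniqueness is required of walks, not just of paths, and also for \<open>u = r\<close>: this
  excludes cycles and arcs leaving the root.
\<close>

definition in_arborescence :: "'a pair_pre_digraph \<Rightarrow> 'a \<Rightarrow> bool" where
  "in_arborescence A r \<longleftrightarrow>
     pair_wf_digraph A \<and> r \<in> pverts A \<and> (\<forall>u\<in>pverts A. \<exists>!p. is_walk A u p r)"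

definition path_union ::
  "('a \<Rightarrow> 'a \<Rightarrow> ('a \<times> 'a) awalk) \<Rightarrow> 'a set \<Rightarrow> 'a \<Rightarrow> 'a pair_pre_digraph" where
  "path_union pm U v =
     \<lparr>pverts = insert v (\<Union>u\<in>U. set (pawalk_verts u (pm u v))),
      parcs = (\<Union>u\<in>U. set (pm u v))\<rparr>"

text \<open>
  \<open>pm u v\<close> is the chosen most probable path from \<open>u\<close> to \<open>v\<close>. It is unconstrained when
  \<open>u = v\<close> or when there is no path from \<open>u\<close> to \<open>v\<close>; those values are never used.
\<close>

definition max_path_choice ::
  "'a pair_pre_digraph \<Rightarrow> ('a \<times> 'a \<Rightarrow> real) \<Rightarrow> ('a \<Rightarrow> 'a \<Rightarrow> ('a \<times> 'a) awalk) \<Rightarrow> bool" where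
  "max_path_choice G P pm \<longleftrightarrow>
     (\<forall>u\<in>pverts G. \<forall>v\<in>pverts G.
        u \<noteq> v \<and> (\<exists>p. is_path G u p v) \<longrightarrow> max_path G P u (pm u v) v) \<and>
     (\<forall>v\<in>pverts G.
        in_arborescence (path_union pm {u \<in> pverts G - {v}. \<exists>p. is_path G u p v} v) v)"

definition propagation_prob ::
  "'a pair_pre_digraph \<Rightarrow> ('a \<times> 'a \<Rightarrow> real) \<Rightarrow> ('a \<Rightarrow> 'a \<Rightarrow> ('a \<times> 'a) awalk)
     \<Rightarrow> 'a \<Rightarrow> 'a \<Rightarrow> real" where
  "propagation_prob G P pm u v =
     (if \<exists>p. is_path G u p v then path_prob P (pm u v) else 0)"

definition MIIA ::
  "'a pair_pre_digraph \<Rightarrow> ('a \<times> 'a \<Rightarrow> real) \<Rightarrow> ('a \<Rightarrow> 'a \<Rightarrow> ('a \<times> 'a) awalk)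
     \<Rightarrow> 'a \<Rightarrow> real \<Rightarrow> 'a pair_pre_digraph" where
  "MIIA G P pm v \<theta> =
     path_union pm {u \<in> pverts G - {v}. propagation_prob G P pm u v \<ge> \<theta>} v"

text \<open>
  For an arbitrary \<open>A\<close> the recursion need not terminate, so \<open>ap\<close> is introduced
  as a partial function; \<open>ap_rec\<close> and \<open>in_arborescence_MIIA\<close> below show that
  the recursion equation holds throughout every \<open>MIIA G P pm v \<theta>\<close>.
\<close>

function (domintros) ap ::
  "('a \<times> 'a \<Rightarrow> real) \<Rightarrow> 'a \<Rightarrow> 'a set \<Rightarrow> 'a pair_pre_digraph \<Rightarrow> real" where
  "ap P u S A =
     (if u \<in> S then 1
      else if {w. (w, u) \<in> parcs A} = {} then 0
      else 1 - (\<Prod>w\<in>{w. (w, u) \<in> parcs A}. 1 - ap P w S A * P (w, u)))"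
  by auto

definition influence ::
  "'a pair_pre_digraph \<Rightarrow> ('a \<times> 'a \<Rightarrow> real) \<Rightarrow> ('a \<Rightarrow> 'a \<Rightarrow> ('a \<times> 'a) awalk)
     \<Rightarrow> real \<Rightarrow> 'a set \<Rightarrow> real" where
  "influence G P pm \<theta> S = (\<Sum>v\<in>pverts G. ap P v S (MIIA G P pm v \<theta>))"

text \<open>A co-operative game: the player set together with the utility function.\<close>

definition BIM_game ::
  "'a pair_pre_digraph \<Rightarrow> ('a \<times> 'a \<Rightarrow> real) \<Rightarrow> ('a \<Rightarrow> 'a \<Rightarrow> ('a \<times> 'a) awalk)
     \<Rightarrow> real \<Rightarrow> 'a set \<times> ('a set \<Rightarrow> real)" where
  "BIM_game G P pm \<theta> = (pverts G, influence G P pm \<theta>)"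

lemma in_arborescence_acyclic:
  assumes "in_arborescence A r"
  shows "acyclic (parcs A)"
proof -
  interpret pair_wf_digraph A using assms by (simp add: in_arborescence_def)
  have False if cyc: "(x, x) \<in> (parcs A)\<^sup>+" for x
  proof -
    obtain c where c: "awalk x c x" "c \<noteq> []"
      using cyc reachable1_awalk[of x x] by blast
    then have "x \<in> pverts A" by (auto simp: awalk_def)
    then have ex1: "\<exists>!p. awalk x p r"
      using assms by (simp add: in_arborescence_def)
    then obtain p where p: "awalk x p r" by (rule ex1E)
    have "awalk x (c @ p) r" using c(1) p by (rule awalk_appendI)
    with ex1 p have "c @ p = p" by blast
    with c(2) show False by simp
  qed
  then show ?thesis by (auto simp: acyclic_def)
qed

lemma ap_rec:
  assumes "in_arborescence A r" and "finite (parcs A)"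
  shows "ap P u S A =
     (if u \<in> S then 1
      else if {w. (w, u) \<in> parcs A} = {} then 0
      else 1 - (\<Prod>w\<in>{w. (w, u) \<in> parcs A}. 1 - ap P w S A * P (w, u)))"
proof -
  have "wf (parcs A)"
    by (rule finite_acyclic_wf[OF assms(2) in_arborescence_acyclic[OF assms(1)]])
  then have "ap_dom (P, u, S, A)"
  proof (induction u rule: wf_induct_rule)
    case (less u)
    then show ?case by (rule ap.domintros)
  qed
  then show ?thesis by (rule ap.psimps)
qed

lemma in_arborescence_MIIA:
  assumes net: "social_network G P" and pm: "max_path_choice G P pm"
    and "0 < \<theta>" and v: "v \<in> pverts G"
  shows "in_arborescence (MIIA G P pm v \<theta>) v" and "finite (parcs (MIIA G P pm v \<theta>))"
proof -
  interpret social_network G P by (rule net)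
  let ?U = "{u \<in> pverts G - {v}. propagation_prob G P pm u v \<ge> \<theta>}"
  let ?B = "path_union pm {u \<in> pverts G - {v}. \<exists>p. is_path G u p v} v"
  let ?M = "MIIA G P pm v \<theta>"
  have B: "in_arborescence ?B v" using pm v by (auto simp: max_path_choice_def)
  have sub: "?U \<subseteq> {u \<in> pverts G - {v}. \<exists>p. is_path G u p v}"
    using \<open>0 < \<theta>\<close> by (auto simp: propagation_prob_def split: if_splits)
  have subV: "pverts ?M \<subseteq> pverts ?B" and subE: "parcs ?M \<subseteq> parcs ?B"
    using sub by (auto simp: MIIA_def path_union_def)
  have path: "apath u (pm u v) v" if "u \<in> ?U" for u
    using that sub pm v unfolding max_path_choice_def max_path_def by blast
  show "finite (parcs ?M)"
    by (auto simp: MIIA_def path_union_def)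
  have hd: "u \<in> set (pawalk_verts u p)" if "pcas u p w" for u p w
    using that by (cases p) auto
  have ends: "fst e \<in> set (pawalk_verts u p) \<and> snd e \<in> set (pawalk_verts u p)"
    if "e \<in> set p" "pcas u p w" for e u p w
    using that
  proof (induction p arbitrary: u)
    case (Cons d p)
    then show ?case using hd[of "snd d" p w] by auto
  qed simp
  have wf: "pair_wf_digraph ?M"
  proof
    fix e assume "e \<in> parcs ?M"
    then obtain u where u: "u \<in> ?U" "e \<in> set (pm u v)"
      by (auto simp: MIIA_def path_union_def)
    then show "fst e \<in> pverts ?M" "snd e \<in> pverts ?M"
      using ends[of e "pm u v" u v] path[OF u(1)]
      by (auto simp: MIIA_def path_union_def apath_def awalk_def)
  qed
  interpret M: pair_wf_digraph ?M by (rule wf)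
  have "\<exists>!p. M.awalk x p v" if x: "x \<in> pverts ?M" for x
  proof (rule ex_ex1I)
    show "\<exists>p. M.awalk x p v"
    proof (cases "x = v")
      case True
      then show ?thesis using x by (auto simp: M.awalk_def intro: exI[of _ "[]"])
    next
      case False
      then obtain u where u: "u \<in> ?U" "x \<in> set (pawalk_verts u (pm u v))"
        using x by (auto simp: MIIA_def path_union_def)
      have "set (pm u v) \<subseteq> parcs ?M" using u by (auto simp: MIIA_def path_union_def)
      moreover have "u \<in> pverts ?M"
      proof -
        have "u \<in> set (pawalk_verts u (pm u v))"
          using path[OF u(1)] by (cases "pm u v") (auto simp: apath_def awalk_def)
        then show ?thesis using u by (auto simp: MIIA_def path_union_def)
      qed
      ultimately have "M.awalk u (pm u v) v"
        using path[OF u(1)] by (auto simp: apath_def awalk_def M.awalk_def)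
      then show ?thesis using u(2) M.awalk_decomp by blast
    qed
  next
    fix p q assume "M.awalk x p v" "M.awalk x q v"
    then have "is_walk ?B x p v" "is_walk ?B x q v" "x \<in> pverts ?B"
      using subV subE
      by (auto simp: pre_digraph.awalk_def cas_with_proj_eq)
    then show "p = q" using B unfolding in_arborescence_def by blast
  qed
  then show "in_arborescence ?M v"
    using wf by (auto simp: in_arborescence_def) (auto simp: MIIA_def path_union_def)
qed

end

theory Submission
  imports Defs
begin

text \<open>
  The activation probability satisfies the stronger inequality
  \<open>(1 - ap S) (1 - ap T) \<le> 1 - ap (S \<union> T)\<close>, which, unlike subadditivity itself,
  passes through the products of the recursion: it implies
  \<open>(1 - p ap S) (1 - p ap T) \<le> 1 - p ap (S \<union> T)\<close> for \<open>0 \<le> p \<le> 1\<close>, because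
  \<open>p\<^sup>2 \<le> p\<close>. Subadditivity of \<open>ap\<close> follows and is summed over all nodes.
\<close>

text \<open>The empty product is 1, so the case without in-neighbours is an instance of the product
  formula.\<close>

lemma ap_eq:
  assumes "in_arborescence A r" and "finite (parcs A)"
  shows "ap P u S A =
     (if u \<in> S then 1 else 1 - (\<Prod>w\<in>{w. (w, u) \<in> parcs A}. 1 - ap P w S A * P (w, u)))"
  by (subst ap_rec[OF assms]) simp

lemma in_arborescence_induct [consumes 2, case_names less]:
  assumes "in_arborescence A r" and "finite (parcs A)"
    and "\<And>u. (\<And>w. (w, u) \<in> parcs A \<Longrightarrow> Q w) \<Longrightarrow> Q u"
  shows "Q u"
  using finite_acyclic_wf[OF assms(2) in_arborescence_acyclic[OF assms(1)]] assms(3)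
  by (rule wf_induct_rule)

lemma ap_bounds:
  assumes "in_arborescence A r" and "finite (parcs A)"
    and P: "\<And>e. 0 \<le> P e \<and> P e \<le> 1"
  shows "0 \<le> ap P u S A \<and> ap P u S A \<le> 1"
  using assms(1,2)
proof (induction u rule: in_arborescence_induct)
  case (less u)
  let ?f = "\<lambda>w. 1 - ap P w S A * P (w, u)"
  have "0 \<le> ?f w \<and> ?f w \<le> 1" if "(w, u) \<in> parcs A" for w
    using less[OF that] P[of "(w, u)"] by (simp add: mult_le_one)
  then have "0 \<le> prod ?f {w. (w, u) \<in> parcs A}" "prod ?f {w. (w, u) \<in> parcs A} \<le> 1"
    by (auto intro!: prod_nonneg prod_le_1)
  then show ?case by (subst (1 2) ap_eq[OF assms(1,2)]) auto
qed

lemma complement_scale: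
  fixes a b c p :: real
  assumes "(1 - a) * (1 - b) \<le> 1 - c" "0 \<le> a" "0 \<le> b" "0 \<le> p" "p \<le> 1"
  shows "(1 - a * p) * (1 - b * p) \<le> 1 - c * p"
proof -
  \<comment> \<open>The hypothesis says \<open>c \<le> a + b - a * b\<close>; the left-hand side of
    the goal is \<open>1 - (a + b) * p + a * b * p * p\<close>.\<close>
  have "c * p \<le> (a + b - a * b) * p"
    using assms by (intro mult_right_mono) (simp_all add: algebra_simps)
  moreover have "(a * b) * (p * p) \<le> (a * b) * p"
    using assms by (intro mult_left_mono) (simp_all add: mult_left_le)
  ultimately show ?thesis by (simp add: algebra_simps)
qed

lemma ap_Un_complement:
  assumes "in_arborescence A r" and "finite (parcs A)"
    and P: "\<And>e. 0 \<le> P e \<and> P e \<le> 1"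
  shows "(1 - ap P u S A) * (1 - ap P u T A) \<le> 1 - ap P u (S \<union> T) A"
  using assms(1,2)
proof (induction u rule: in_arborescence_induct)
  case (less u)
  note eq = ap_eq[OF assms(1,2), of P u]
  show ?case
  proof (cases "u \<in> S \<union> T")
    \<comment> \<open>Both sides vanish: a seed in \<open>S\<close> or \<open>T\<close> makes a
      factor on the left 0.\<close>
    case True
    then show ?thesis using eq[of S] eq[of T] eq[of "S \<union> T"] by auto
  next
    case False
    let ?W = "{w. (w, u) \<in> parcs A}"
    let ?f = "\<lambda>S w. 1 - ap P w S A * P (w, u)"
    note bd = ap_bounds[where P=P, OF assms]
    have nonneg: "0 \<le> ?f S w" for S w
      using bd[where u=w and S=S] P[of "(w, u)"] by (simp add: mult_le_one)
    \<comment> \<open>\<open>A\<close> does not depend on the seed set, so both products range over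
      the same in-neighbours and can be compared factor by factor.\<close>
    have "prod (?f S) ?W * prod (?f T) ?W = (\<Prod>w\<in>?W. ?f S w * ?f T w)"
      by (rule prod.distrib[symmetric])
    also have "\<dots> \<le> prod (?f (S \<union> T)) ?W"
      using less nonneg bd P by (intro prod_mono) (auto intro!: complement_scale)
    finally show ?thesis using False eq[of S] eq[of T] eq[of "S \<union> T"] by simp
  qed
qed

lemma ap_subadditive:
  assumes "in_arborescence A r" and "finite (parcs A)"
    and "\<And>e. 0 \<le> P e \<and> P e \<le> 1"
  shows "ap P u (S \<union> T) A \<le> ap P u S A + ap P u T A"
proof -
  \<comment> \<open>This is the cross term left when the complement inequality is expanded.\<close>
  have "0 \<le> ap P u S A * ap P u T A"
    using ap_bounds[where P=P, OF assms] by simp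
  then show ?thesis
    using ap_Un_complement[where P=P, OF assms, where u=u and S=S and T=T] by (simp add: algebra_simps)
qed

theorem proposition3:
  fixes G :: "'a pair_pre_digraph"
    and P :: "'a \<times> 'a \<Rightarrow> real"
    and pm :: "'a \<Rightarrow> 'a \<Rightarrow> ('a \<times> 'a) awalk"
    and \<theta> :: real
    and N :: "'a set"
    and \<nu> :: "'a set \<Rightarrow> real"
    and U1 U2 :: "'a set"
  assumes "social_network G P"
    and "max_path_choice G P pm"
    and "0 < \<theta>" and "\<theta> \<le> 1"
    and "(N, \<nu>) = BIM_game G P pm \<theta>"
    and "U1 \<subseteq> N" and "U2 \<subseteq> N"
  shows "\<nu> (U1 \<union> U2) \<le> \<nu> U1 + \<nu> U2"
proof -
  interpret social_network G P by (rule assms(1))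
  have \<nu>: "\<nu> = influence G P pm \<theta>"
    using assms(5) by (simp add: BIM_game_def)
  \<comment> \<open>Since \<open>P\<close> is 0 off the arcs, the bounds hold for all pairs.\<close>
  have P: "0 \<le> P e \<and> P e \<le> 1" for e
    using P_arc[of e] P_non_arc[of e] by (cases "e \<in> parcs G") auto
  show ?thesis
    unfolding \<nu> influence_def sum.distrib[symmetric]
    by (intro sum_mono ap_subadditive[OF in_arborescence_MIIA] assms(1-3) P)
qed

end
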